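(* Let $p\ge1$ and consider the fully composite problem $\varphi^*=\min_{x\in\operatorname{dom}\varphi}\{\varphi(x)=F(x,f(x))\}$ with subhomogeneous outer function (see context), where each component of $f$ is convex and $p$ times continuously differentiable with Lipschitz continuous $p$th derivative, and $F(L_p(f))<+\infty$. Let $x_0\in\operatorname{dom}\varphi$ and assume that the initial level set is bounded: $$D_0=\sup_x\{\|x-x^*\|:\varphi(x)\le\varphi(x_0)\}<+\infty.$$ Let $\{x_k\}$ be generated by the Full-step $p$th order Basic Method $$x_{k+1}\in\operatorname*{argmin}_{y\in\operatorname{dom}\varphi}F\Big(y,\ \Omega_p(f,x_k;y)+\tfrac{p\,L_p(f)}{(p+1)!}\|y-x_k\|^{p+1}\Big),\qquad k\ge0$$ (minimizers are assumed to exist). Then for all $k\ge1$, $$\varphi(x_k)-\varphi^*\ \le\ \frac{(p+1)^{p+1}F(L_p(f))D_0^{p+1}}{p!}\cdot k^{-p}.$$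
   Context: $\mathbb{E}$ is a finite-dimensional real vector space with norm $\|x\|=\langle Bx,x\rangle^{1/2}$, where $B:\mathbb{E}\to\mathbb{E}^*$ is self-adjoint positive definite. Fully composite problem: $F:\mathbb{E}\times\mathbb{R}^m\to\mathbb{R}\cup\{+\infty\}$ is closed and convex, and for every $x$ the function $F(x,\cdot)$ is monotone: $u\le v$ componentwise implies $F(x,u)\le F(x,v)$. $f=(f_1,\dots,f_m)^T:\operatorname{dom} f\to\mathbb{R}^m$ with $\operatorname{dom} f\subseteq\mathbb{E}$ open convex, and all $f_i$ closed and convex. $\varphi(x)=F(x,f(x))$, $\operatorname{dom}\varphi=\{x\in\operatorname{dom} f:F(x,f(x))<+\infty\}$ (with $\varphi=+\infty$ elsewhere), and a minimizer $x^*$ with $\varphi(x^* )=\varphi^*$ is assumed to exist. Subhomogeneity: for every $x\in\operatorname{dom}\varphi$, $F(x,\cdot)$ is finite on all of $\mathbb{R}^m$ and $F(x,u+tv)\le F(x,u)+tF(x,v)$ for all $u,v\in\mathbb{R}^m$, $t\ge0$. $D^kf(x)[h]^k$ is the $k$th directional derivative along $h$ repeated $k$ times (componentwise); $\Omega_p(f,x;y)=f(x)+\sum_{k=1}^p\frac1{k!}D^kf(x)[y-x]^k$. $\|D^pg(x)\|=\max\{D^pg(x)[h_1,\dots,h_p]:\|h_i\|\le1\}$, and $L_p(g)<+\infty$ is a constant with $\|D^pg(x)-D^pg(y)\|\le L_p(g)\|x-y\|$ on $\operatorname{dom} f$; $L_p(f)=(L_p(f_1),\dots,L_p(f_m))^T$.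 Notation: $F(L_p(f))=\sup_{x\in\operatorname{dom}\varphi}F(x,L_p(f))$. *)

theory Defs
  imports "HOL-Analysis.Analysis"
begin

text \<open>
  The space is equipped with a map \<open>B\<close> into its dual; \<open>pos_def B\<close> says that \<open>B\<close> is linear,
  self-adjoint and positive definite. All metric quantities below use \<open>norm_B B\<close>; the built-in
  norm of the type only supplies the (unique) vector space topology.
\<close>

definition pos_def :: "('a::euclidean_space \<Rightarrow> 'a \<Rightarrow>\<^sub>L real) \<Rightarrow> bool" where
  "pos_def B \<longleftrightarrow> linear B \<and> (\<forall>x y. blinfun_apply (B x) y = blinfun_apply (B y) x)
     \<and> (\<forall>x. x \<noteq> 0 \<longrightarrow> blinfun_apply (B x) x > 0)"

definition norm_B :: "('a::euclidean_space \<Rightarrow> 'a \<Rightarrow>\<^sub>L real) \<Rightarrow> 'a \<Rightarrow> real" where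
  "norm_B B x = sqrt (blinfun_apply (B x) x)"


text \<open>
  \<open>Dk g [h\<^sub>1, \<dots>, h\<^sub>k] x\<close> is \<open>D\<^sup>k g(x)[h\<^sub>1, \<dots>, h\<^sub>k]\<close>. The order in which the directions are
  differentiated is immaterial where \<open>g\<close> is \<open>k\<close> times continuously differentiable.
\<close>

primrec Dk :: "('a::euclidean_space \<Rightarrow> real) \<Rightarrow> 'a list \<Rightarrow> 'a \<Rightarrow> real" where
  "Dk g [] = g"
| "Dk g (h # hs) = (\<lambda>x. frechet_derivative (Dk g hs) (at x) h)"

text \<open>
  Since the space is finite-dimensional, continuity of all \<open>D\<^sup>k g(\<cdot>)[h\<^sub>1, \<dots>, h\<^sub>k]\<close> for fixed
  directions is continuity of the multilinear form \<open>D\<^sup>k g(\<cdot>)\<close>.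
\<close>

definition times_cont_diff_on :: "nat \<Rightarrow> 'a::euclidean_space set \<Rightarrow> ('a \<Rightarrow> real) \<Rightarrow> bool" where
  "times_cont_diff_on p S g \<longleftrightarrow>
     (\<forall>hs. length hs < p \<longrightarrow> (\<forall>x\<in>S. Dk g hs differentiable (at x))) \<and>
     (\<forall>hs. length hs \<le> p \<longrightarrow> continuous_on S (Dk g hs))"

text \<open>
  Norm of a \<open>p\<close>-linear form \<open>T\<close>. The supremum, a maximum by compactness, is taken in \<^typ>\<open>ereal\<close>.
\<close>

definition form_norm ::
    "('a::euclidean_space \<Rightarrow> 'a \<Rightarrow>\<^sub>L real) \<Rightarrow> nat \<Rightarrow> ('a list \<Rightarrow> real) \<Rightarrow> ereal" where
  "form_norm B p T = (SUP hs \<in> {hs. length hs = p \<and> (\<forall>h\<in>set hs. norm_B B h \<le> 1)}. ereal (T hs))"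

definition lipschitz_Dp ::
    "('a::euclidean_space \<Rightarrow> 'a \<Rightarrow>\<^sub>L real) \<Rightarrow> nat \<Rightarrow> 'a set \<Rightarrow> ('a \<Rightarrow> real) \<Rightarrow> real \<Rightarrow> bool" where
  "lipschitz_Dp B p S g L \<longleftrightarrow>
     (\<forall>x\<in>S. \<forall>y\<in>S. form_norm B p (\<lambda>hs. Dk g hs x - Dk g hs y) \<le> ereal (L * norm_B B (x - y)))"

definition taylor :: "nat \<Rightarrow> ('a::euclidean_space \<Rightarrow> real ^ 'm) \<Rightarrow> 'a \<Rightarrow> 'a \<Rightarrow> real ^ 'm" where
  "taylor p f x y =
     f x + (\<Sum>k=1..p. (1 / fact k) *\<^sub>R (\<chi> i. Dk (\<lambda>z. f z $ i) (replicate k (y - x)) x))"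


definition closed_convex_ext :: "('b::real_normed_vector \<Rightarrow> ereal) \<Rightarrow> bool" where
  "closed_convex_ext G \<longleftrightarrow>
     closed {(z, t::real). G z \<le> ereal t} \<and> convex {(z, t::real). G z \<le> ereal t}"

text \<open>In what follows, \<open>S\<close> is the domain of \<open>f\<close>.\<close>

definition phi ::
    "('a \<Rightarrow> real ^ 'm \<Rightarrow> ereal) \<Rightarrow> 'a set \<Rightarrow> ('a \<Rightarrow> real ^ 'm) \<Rightarrow> 'a \<Rightarrow> ereal" where
  "phi F S f x = (if x \<in> S then F x (f x) else \<infinity>)"

definition dom_phi ::
    "('a \<Rightarrow> real ^ 'm \<Rightarrow> ereal) \<Rightarrow> 'a set \<Rightarrow> ('a \<Rightarrow> real ^ 'm) \<Rightarrow> 'a set" where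
  "dom_phi F S f = {x \<in> S. F x (f x) < \<infinity>}"

definition subhomogeneous_on :: "'a set \<Rightarrow> ('a \<Rightarrow> real ^ 'm \<Rightarrow> ereal) \<Rightarrow> bool" where
  "subhomogeneous_on X F \<longleftrightarrow>
     (\<forall>x\<in>X. (\<forall>u. \<bar>F x u\<bar> \<noteq> \<infinity>) \<and>
        (\<forall>u v t. 0 \<le> t \<longrightarrow> F x (u + t *\<^sub>R v) \<le> F x u + ereal t * F x v))"

definition outer_sup ::
    "('a \<Rightarrow> real ^ 'm \<Rightarrow> ereal) \<Rightarrow> 'a set \<Rightarrow> ('a \<Rightarrow> real ^ 'm) \<Rightarrow> real ^ 'm \<Rightarrow> ereal" where
  "outer_sup F S f v = (SUP x \<in> dom_phi F S f. F x v)"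

definition level_radius ::
    "('a::euclidean_space \<Rightarrow> 'a \<Rightarrow>\<^sub>L real) \<Rightarrow> ('a \<Rightarrow> ereal) \<Rightarrow> 'a \<Rightarrow> 'a \<Rightarrow> ereal" where
  "level_radius B \<phi> xs x0 = (SUP x \<in> {x. \<phi> x \<le> \<phi> x0}. ereal (norm_B B (x - xs)))"

definition full_step_model ::
    "('a::euclidean_space \<Rightarrow> 'a \<Rightarrow>\<^sub>L real) \<Rightarrow> nat \<Rightarrow> ('a \<Rightarrow> real ^ 'm \<Rightarrow> ereal) \<Rightarrow>
     ('a \<Rightarrow> real ^ 'm) \<Rightarrow> real ^ 'm \<Rightarrow> 'a \<Rightarrow> 'a \<Rightarrow> ereal" where
  "full_step_model B p F f L x y =
     F y (taylor p f x y + (norm_B B (y - x) ^ (p + 1)) *\<^sub>R ((real p / fact (p + 1)) *\<^sub>R L))"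

end

theory Submission
  imports Defs
begin

text \<open>
  The regularised model \<open>\<Omega>\<^sub>p(f, x; y) + p L / (p+1)! \<cdot> \<parallel>y - x\<parallel>\<^sup>p\<^sup>+\<^sup>1\<close> lies between \<open>f(y)\<close> and
  \<open>f(y) + L / p! \<cdot> \<parallel>y - x\<parallel>\<^sup>p\<^sup>+\<^sup>1\<close>, since the Taylor remainder is at most
  \<open>L / (p+1)! \<cdot> \<parallel>y - x\<parallel>\<^sup>p\<^sup>+\<^sup>1\<close> in absolute value (\<open>taylor_remainder_bound\<close>). Inserting both
  bounds into the monotone subhomogeneous \<open>F\<close> shows that the next iterate \<open>x\<^sub>k\<^sub>+\<^sub>1\<close> satisfies
  \<open>\<phi>(x\<^sub>k\<^sub>+\<^sub>1) \<le> \<phi>(y) + F(L) / p! \<cdot> \<parallel>y - x\<^sub>k\<parallel>\<^sup>p\<^sup>+\<^sup>1\<close> for every \<open>y\<close> in the domain of \<open>\<phi>\<close>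
  (\<open>full_step_progress\<close>).

  Taking \<open>y = x\<^sub>k\<close> shows that the method never leaves the initial level set, hence
  \<open>\<parallel>x\<^sub>k - x\<^sup>*\<parallel> \<le> D\<^sub>0\<close>. Taking \<open>y = (1 - \<alpha>) x\<^sub>k + \<alpha> x\<^sup>*\<close> and using the convexity of \<open>\<phi>\<close>
  (\<open>composite_convex\<close>), the gaps \<open>\<delta>\<^sub>k = \<phi>(x\<^sub>k) - \<phi>\<^sup>*\<close> obey
  \<open>\<delta>\<^sub>k\<^sub>+\<^sub>1 \<le> (1 - \<alpha>) \<delta>\<^sub>k + C \<alpha>\<^sup>p\<^sup>+\<^sup>1\<close> for all \<open>\<alpha>\<close> in \<open>[0, 1]\<close>, with
  \<open>C = F(L) D\<^sub>0\<^sup>p\<^sup>+\<^sup>1 / p!\<close>. The choice \<open>\<alpha> = (p+1) / (k+p+1)\<close> turns this into the rate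
  (\<open>recurrence_rate\<close>). Replacing \<open>F(y, L)\<close> by its supremum and \<open>\<parallel>x\<^sub>k - x\<^sup>*\<parallel>\<close> by \<open>D\<^sub>0\<close> is
  legitimate because \<open>L \<ge> 0\<close> (\<open>lipschitz_Dp_constant_nonneg\<close>) and hence \<open>F(y, L) \<ge> 0\<close>
  (\<open>subhomogeneous_nonneg\<close>).
\<close>

section \<open>The norm induced by B\<close>

lemma norm_B_scaleR:
  assumes "pos_def B"
  shows "norm_B B (c *\<^sub>R h) = \<bar>c\<bar> * norm_B B h"
proof -
  have "B (c *\<^sub>R h) = c *\<^sub>R B h"
    using assms by (simp add: pos_def_def linear_cmul)
  then have "blinfun_apply (B (c *\<^sub>R h)) (c *\<^sub>R h) = c\<^sup>2 * blinfun_apply (B h) h"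
    by (simp add: blinfun.scaleR_left blinfun.scaleR_right power2_eq_square)
  then show ?thesis
    by (simp add: norm_B_def real_sqrt_mult)
qed

lemma norm_B_pos:
  assumes "pos_def B" "h \<noteq> 0"
  shows "norm_B B h > 0"
  using assms by (simp add: norm_B_def pos_def_def)

lemma norm_B_nonneg:
  assumes "pos_def B"
  shows "norm_B B h \<ge> 0"
  using norm_B_pos[OF assms, of h] by (cases "h = 0") (auto simp: norm_B_def)

section \<open>Iterated directional derivatives\<close>

lemma Dk_has_derivative:
  assumes "times_cont_diff_on p S g" "length hs < p" "x \<in> S"
  shows "(Dk g hs has_derivative (\<lambda>h. Dk g (h # hs) x)) (at x)"
  using assms by (simp add: times_cont_diff_on_def frechet_derivative_works)

text \<open>
  By induction on \<open>k\<close>: on the open set \<open>S\<close> the functions \<open>D\<^sup>k g(\<cdot>)[c h]\<^sup>k\<close> and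
  \<open>c\<^sup>k D\<^sup>k g(\<cdot>)[h]\<^sup>k\<close> coincide and so have the same derivative there, and the outermost
  derivative is linear in its own direction.
\<close>

lemma Dk_replicate_scaleR:
  assumes g: "times_cont_diff_on p S g" and "open S" and "k \<le> p" and "x \<in> S"
  shows "Dk g (replicate k (c *\<^sub>R h)) x = c ^ k * Dk g (replicate k h) x"
  using \<open>k \<le> p\<close> \<open>x \<in> S\<close>
proof (induction k arbitrary: x)
  case 0
  then show ?case by simp
next
  case (Suc k)
  have d: "(Dk g (replicate k h) has_derivative (\<lambda>v. Dk g (v # replicate k h) x)) (at x)"
    by (rule Dk_has_derivative[OF g]) (use Suc.prems in auto)
  have "(Dk g (replicate k (c *\<^sub>R h)) has_derivative (\<lambda>v. c ^ k * Dk g (v # replicate k h) x)) (at x)"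
    by (rule has_derivative_transform_within_open[OF has_derivative_mult_right[OF d] \<open>open S\<close> \<open>x \<in> S\<close>])
      (use Suc in auto)
  then have "Dk g (replicate (Suc k) (c *\<^sub>R h)) x = c ^ k * Dk g ((c *\<^sub>R h) # replicate k h) x"
    by (simp add: frechet_derivative_at[symmetric])
  also have "Dk g ((c *\<^sub>R h) # replicate k h) x = c * Dk g (h # replicate k h) x"
    using linear_cmul[OF has_derivative_linear[OF d]] by simp
  finally show ?case by simp
qed

lemma Dk_replicate_zero:
  assumes "times_cont_diff_on p S g" "open S" "1 \<le> p" "x \<in> S"
  shows "Dk g (replicate p 0) x = 0"
  using Dk_replicate_scaleR[OF assms(1,2) order_refl assms(4), of 0 0] \<open>1 \<le> p\<close> by (simp add: power_0_left)

lemma Dk_along_line_has_derivative: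
  assumes "times_cont_diff_on p S g" "k < p" "x + t *\<^sub>R h \<in> S"
  shows "((\<lambda>t. Dk g (replicate k h) (x + t *\<^sub>R h)) has_real_derivative
           Dk g (replicate (Suc k) h) (x + t *\<^sub>R h)) (at t)"
proof -
  let ?G = "\<lambda>v. Dk g (v # replicate k h) (x + t *\<^sub>R h)"
  have d: "(Dk g (replicate k h) has_derivative ?G) (at (x + t *\<^sub>R h))"
    by (rule Dk_has_derivative[OF assms(1)]) (use assms in auto)
  have "((\<lambda>t. x + t *\<^sub>R h) has_derivative (\<lambda>s. s *\<^sub>R h)) (at t)"
    by (auto intro!: derivative_eq_intros)
  from has_derivative_compose[OF this d]
  have "((\<lambda>t. Dk g (replicate k h) (x + t *\<^sub>R h)) has_derivative (\<lambda>s. ?G (s *\<^sub>R h))) (at t)" .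
  moreover have "(\<lambda>s. ?G (s *\<^sub>R h)) = (\<lambda>s. ?G h * s)"
    using linear_cmul[OF has_derivative_linear[OF d]] by (simp add: mult.commute)
  ultimately show ?thesis
    by (simp add: has_field_derivative_def)
qed

text \<open>
  The form norm only tests directions in the unit ball; homogeneity carries the Lipschitz bound
  to all directions, and exchanging the two points makes it two-sided.
\<close>

lemma lipschitz_Dp_bound:
  assumes B: "pos_def B" and g: "times_cont_diff_on p S g" and "open S"
    and lip: "lipschitz_Dp B p S g L" and "1 \<le> p" and "x \<in> S" "y \<in> S"
  shows "Dk g (replicate p h) x - Dk g (replicate p h) y \<le> L * norm_B B (x - y) * norm_B B h ^ p"
proof (cases "h = 0")
  case True
  have "norm_B B (0 :: 'a) = 0"
    using norm_B_scaleR[OF B, of 0 0] by simp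
  then show ?thesis
    using True Dk_replicate_zero[OF g \<open>open S\<close> \<open>1 \<le> p\<close>] assms by (simp add: power_0_left)
next
  case False
  define r where "r = norm_B B h"
  define e where "e = (1 / r) *\<^sub>R h"
  have "r > 0"
    using norm_B_pos[OF B False] by (simp add: r_def)
  have h: "h = r *\<^sub>R e"
    using \<open>r > 0\<close> by (simp add: e_def)
  have "norm_B B e = 1"
    using \<open>r > 0\<close> by (simp add: e_def norm_B_scaleR[OF B] flip: r_def)
  then have "ereal (Dk g (replicate p e) x - Dk g (replicate p e) y)
      \<le> form_norm B p (\<lambda>hs. Dk g hs x - Dk g hs y)"
    unfolding form_norm_def by (intro SUP_upper) auto
  also have "\<dots> \<le> ereal (L * norm_B B (x - y))"
    using lip \<open>x \<in> S\<close> \<open>y \<in> S\<close> by (simp add: lipschitz_Dp_def)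
  finally have "Dk g (replicate p e) x - Dk g (replicate p e) y \<le> L * norm_B B (x - y)"
    by simp
  then have "r ^ p * (Dk g (replicate p e) x - Dk g (replicate p e) y)
      \<le> r ^ p * (L * norm_B B (x - y))"
    using \<open>r > 0\<close> by (intro mult_left_mono) auto
  then show ?thesis
    unfolding h using Dk_replicate_scaleR[OF g \<open>open S\<close> order_refl] \<open>x \<in> S\<close> \<open>y \<in> S\<close>
      norm_B_scaleR[OF B, of r e] \<open>norm_B B e = 1\<close> \<open>r > 0\<close>
    by (simp add: algebra_simps)
qed

text \<open>
  The constant is nonnegative because the space is not zero-dimensional: an open nonempty \<open>S\<close>
  contains two distinct points, and the form norm dominates the value at the zero directions.
\<close>

lemma lipschitz_Dp_constant_nonneg:
  fixes B :: "'a::euclidean_space \<Rightarrow> 'a \<Rightarrow>\<^sub>L real"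
  assumes B: "pos_def B" and g: "times_cont_diff_on p S g" and "open S"
    and lip: "lipschitz_Dp B p S g L" and "1 \<le> p" and "x \<in> S"
  shows "L \<ge> 0"
proof -
  obtain e where "e > 0" "ball x e \<subseteq> S"
    using \<open>open S\<close> \<open>x \<in> S\<close> openE by blast
  obtain b :: 'a where b: "b \<in> Basis"
    using nonempty_Basis by blast
  define y where "y = x + (e / 2) *\<^sub>R b"
  have "y \<in> S" "y \<noteq> x"
    using \<open>e > 0\<close> \<open>ball x e \<subseteq> S\<close> b by (auto simp: y_def dist_norm subset_iff)
  have "ereal 0 = ereal (Dk g (replicate p 0) x - Dk g (replicate p 0) y)"
    using Dk_replicate_zero[OF g \<open>open S\<close> \<open>1 \<le> p\<close>] \<open>x \<in> S\<close> \<open>y \<in> S\<close> by simp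
  also have "\<dots> \<le> form_norm B p (\<lambda>hs. Dk g hs x - Dk g hs y)"
    unfolding form_norm_def using norm_B_scaleR[OF B, of 0 0] by (intro SUP_upper) auto
  also have "\<dots> \<le> ereal (L * norm_B B (x - y))"
    using lip \<open>x \<in> S\<close> \<open>y \<in> S\<close> by (simp add: lipschitz_Dp_def)
  finally have "0 \<le> L * norm_B B (x - y)"
    by simp
  moreover have "norm_B B (x - y) > 0"
    using norm_B_pos[OF B, of "x - y"] \<open>y \<noteq> x\<close> by simp
  ultimately show ?thesis
    by (simp add: zero_le_mult_iff)
qed

section \<open>Taylor remainder for a Lipschitz highest derivative\<close>

text \<open>
  The Lagrange form of the remainder would only give \<open>M / p!\<close>. The sharp \<open>M / (p + 1)!\<close> comes from
  integrating the bound on the highest derivative \<open>p\<close> times: each induction step is one integration,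
  written as monotonicity of the difference of the two sides.
\<close>

lemma taylor_upper_bound_real:
  fixes \<psi> :: "nat \<Rightarrow> real \<Rightarrow> real"
  assumes "\<And>k t. k < p \<Longrightarrow> 0 \<le> t \<Longrightarrow> t \<le> 1 \<Longrightarrow> (\<psi> k has_real_derivative \<psi> (Suc k) t) (at t)"
    and "\<And>t. 0 \<le> t \<Longrightarrow> t \<le> 1 \<Longrightarrow> \<psi> p t \<le> \<psi> p 0 + M * t"
    and "0 \<le> t" "t \<le> 1"
  shows "\<psi> 0 t \<le> (\<Sum>k\<le>p. \<psi> k 0 * t ^ k / fact k) + M * t ^ (p + 1) / fact (p + 1)"
  using assms
proof (induction p arbitrary: \<psi> t)
  case 0
  then show ?case by simp
next
  case (Suc p)
  define E where "E t = \<psi> 0 t - ((\<Sum>k\<le>Suc p. \<psi> k 0 * t ^ k / fact k)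
      + M * t ^ (Suc p + 1) / fact (Suc p + 1))" for t
  define E' where "E' t = \<psi> 1 t - ((\<Sum>k\<le>p. \<psi> (Suc k) 0 * t ^ k / fact k)
      + M * t ^ (p + 1) / fact (p + 1))" for t
  have monomial: "((\<lambda>s. c * s ^ Suc k / fact (Suc k)) has_real_derivative c * s ^ k / fact k) (at s)"
    for c s :: real and k
  proof -
    have "((\<lambda>s. c / fact (Suc k) * s ^ Suc k) has_real_derivative
        c / fact (Suc k) * (real (Suc k) * s ^ k)) (at s)"
      by (intro DERIV_cmult) (use DERIV_pow[of "Suc k" s] in simp)
    also have "c / fact (Suc k) * (real (Suc k) * s ^ k) = c * s ^ k / fact k"
      by (simp add: fact_Suc del: of_nat_Suc)
    finally show ?thesis by simp
  qed
  have dE: "(E has_real_derivative E' s) (at s)" if "0 \<le> s" "s \<le> 1" for s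
  proof -
    have 1: "(\<psi> 0 has_real_derivative \<psi> 1 s) (at s)"
      using Suc.prems(1)[of 0 s] that by simp
    have 2: "((\<lambda>s. \<Sum>k\<le>p. \<psi> (Suc k) 0 * s ^ Suc k / fact (Suc k)) has_real_derivative
        (\<Sum>k\<le>p. \<psi> (Suc k) 0 * s ^ k / fact k)) (at s)"
      by (intro DERIV_sum monomial)
    have "((\<lambda>s. \<psi> 0 s - ((\<psi> 0 0 + (\<Sum>k\<le>p. \<psi> (Suc k) 0 * s ^ Suc k / fact (Suc k)))
        + M * s ^ Suc (p + 1) / fact (Suc (p + 1)))) has_real_derivative
        \<psi> 1 s - ((0 + (\<Sum>k\<le>p. \<psi> (Suc k) 0 * s ^ k / fact k)) + M * s ^ (p + 1) / fact (p + 1))) (at s)"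
      by (rule DERIV_diff[OF 1 DERIV_add[OF DERIV_add[OF DERIV_const 2] monomial]])
    then show ?thesis
      unfolding E_def[abs_def] E'_def sum.atMost_Suc_shift by simp
  qed
  have E'_le: "E' s \<le> 0" if "0 \<le> s" "s \<le> 1" for s
  proof -
    have "\<psi> (Suc 0) s \<le> (\<Sum>k\<le>p. \<psi> (Suc k) 0 * s ^ k / fact k) + M * s ^ (p + 1) / fact (p + 1)"
      using Suc.IH[of "\<lambda>k. \<psi> (Suc k)" s] Suc.prems(1,2) that by auto
    then show ?thesis
      by (simp add: E'_def)
  qed
  have "\<exists>e. (E has_real_derivative e) (at s) \<and> e \<le> 0" if "0 \<le> s" "s \<le> t" for s
    using dE[of s] E'_le[of s] that \<open>t \<le> 1\<close> by fastforce
  then have "E t \<le> E 0"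
    by (rule DERIV_nonpos_imp_nonincreasing[OF \<open>0 \<le> t\<close>])
  also have "E 0 = 0"
    by (simp add: E_def sum.atMost_Suc_shift)
  finally show ?case
    by (simp add: E_def)
qed

lemma taylor_remainder_bound:
  assumes B: "pos_def B" and g: "times_cont_diff_on p S g" and "open S" "convex S"
    and lip: "lipschitz_Dp B p S g L" and "1 \<le> p" and x: "x \<in> S" and y: "y \<in> S"
  shows "\<bar>g y - (\<Sum>k\<le>p. Dk g (replicate k (y - x)) x / fact k)\<bar>
    \<le> L * norm_B B (y - x) ^ (p + 1) / fact (p + 1)"
proof -
  define h where "h = y - x"
  define M where "M = L * norm_B B h ^ (p + 1)"
  define \<psi> where "\<psi> k t = Dk g (replicate k h) (x + t *\<^sub>R h)" for k t
  have seg: "x + t *\<^sub>R h \<in> S" if "0 \<le> t" "t \<le> 1" for t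
  proof -
    have "x + t *\<^sub>R h = (1 - t) *\<^sub>R x + t *\<^sub>R y"
      by (simp add: h_def algebra_simps)
    then show ?thesis
      using convexD_alt[OF \<open>convex S\<close> x y] that by simp
  qed
  have der: "(\<psi> k has_real_derivative \<psi> (Suc k) t) (at t)" if "k < p" "0 \<le> t" "t \<le> 1" for k t
    unfolding \<psi>_def[abs_def] by (rule Dk_along_line_has_derivative[OF g that(1) seg[OF that(2,3)]])
  have lip_psi: "\<psi> p t - \<psi> p 0 \<le> M * t" "\<psi> p 0 - \<psi> p t \<le> M * t" if "0 \<le> t" "t \<le> 1" for t
  proof -
    have "norm_B B (t *\<^sub>R h) = t * norm_B B h" "norm_B B (- (t *\<^sub>R h)) = t * norm_B B h"
      using norm_B_scaleR[OF B, of t h] norm_B_scaleR[OF B, of "- t" h] that by simp_all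
    then show "\<psi> p t - \<psi> p 0 \<le> M * t" "\<psi> p 0 - \<psi> p t \<le> M * t"
      using lipschitz_Dp_bound[OF B g \<open>open S\<close> lip \<open>1 \<le> p\<close> seg[OF that] x, of h]
        lipschitz_Dp_bound[OF B g \<open>open S\<close> lip \<open>1 \<le> p\<close> x seg[OF that], of h]
      by (simp_all add: \<psi>_def M_def mult_ac)
  qed
  have "\<psi> 0 1 \<le> (\<Sum>k\<le>p. \<psi> k 0 * 1 ^ k / fact k) + M * 1 ^ (p + 1) / fact (p + 1)"
    using der lip_psi(1) by (intro taylor_upper_bound_real) (auto simp: algebra_simps)
  moreover have "- \<psi> 0 1 \<le> (\<Sum>k\<le>p. - \<psi> k 0 * 1 ^ k / fact k) + M * 1 ^ (p + 1) / fact (p + 1)"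
    using der lip_psi(2)
    by (intro taylor_upper_bound_real[where \<psi> = "\<lambda>k t. - \<psi> k t"])
      (auto simp: algebra_simps intro!: DERIV_minus)
  ultimately show ?thesis
    by (simp add: \<psi>_def M_def h_def sum_negf abs_le_iff)
qed

lemma taylor_component:
  "taylor p f x y $ i = (\<Sum>k\<le>p. Dk (\<lambda>z. f z $ i) (replicate k (y - x)) x / fact k)"
  by (simp add: taylor_def sum_component atMost_atLeast0 sum.atLeast_Suc_atMost)

section \<open>The outer function\<close>

text \<open>
  Comparing \<open>F(x, u)\<close> with \<open>F(x, u + 1 \<cdot> 0)\<close> gives \<open>F(x, 0) \<ge> 0\<close>; monotonicity does the rest.
\<close>

lemma subhomogeneous_nonneg:
  assumes "subhomogeneous_on X F" "mono (F z)" "z \<in> X" "0 \<le> v"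
  shows "0 \<le> F z v"
proof -
  have "F z (0 + 1 *\<^sub>R 0) \<le> F z 0 + ereal 1 * F z 0"
    using assms(1,3) zero_le_one unfolding subhomogeneous_on_def by blast
  moreover have "\<bar>F z 0\<bar> \<noteq> \<infinity>"
    using assms(1,3) by (simp add: subhomogeneous_on_def)
  ultimately have "0 \<le> F z 0"
    by (cases "F z 0") auto
  also have "\<dots> \<le> F z v"
    using assms(2,4) by (simp add: monoD)
  finally show ?thesis .
qed

text \<open>
  Joint convexity of \<open>F\<close> bounds \<open>F\<close> at the convex combination of \<open>f(x)\<close> and \<open>f(y)\<close>, which lies
  componentwise above \<open>f(z)\<close>, so monotonicity applies.
\<close>

lemma composite_convex:
  fixes F :: "'a::euclidean_space \<Rightarrow> real ^ 'm \<Rightarrow> ereal"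
  assumes cF: "closed_convex_ext (\<lambda>(z, u). F z u)" and mF: "\<And>z. mono (F z)"
    and "convex S" and cf: "\<And>i. convex_on S (\<lambda>z. f z $ i)"
    and x: "x \<in> S" "F x (f x) = ereal r" and y: "y \<in> S" "F y (f y) = ereal s"
    and a: "0 \<le> a" "a \<le> 1" and z: "z = (1 - a) *\<^sub>R x + a *\<^sub>R y"
  shows "z \<in> S \<and> F z (f z) \<le> ereal ((1 - a) * r + a * s)"
proof
  show "z \<in> S"
    using convexD_alt[OF \<open>convex S\<close> x(1) y(1) a] z by simp
  let ?E = "{(w, t::real). (case w of (z, u) \<Rightarrow> F z u) \<le> ereal t}"
  have "convex ?E"
    using cF by (simp add: closed_convex_ext_def)
  moreover have "((x, f x), r) \<in> ?E" "((y, f y), s) \<in> ?E"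
    using x y by auto
  ultimately have "(1 - a) *\<^sub>R ((x, f x), r) + a *\<^sub>R ((y, f y), s) \<in> ?E"
    using a by (intro convexD_alt) auto
  then have le: "F z ((1 - a) *\<^sub>R f x + a *\<^sub>R f y) \<le> ereal ((1 - a) * r + a * s)"
    by (simp add: z)
  have "f z $ i \<le> (1 - a) * f x $ i + a * f y $ i" for i
    using convex_onD[OF cf a x(1) y(1), of i] z by simp
  then have "f z \<le> (1 - a) *\<^sub>R f x + a *\<^sub>R f y"
    by (simp add: less_eq_vec_def)
  with le show "F z (f z) \<le> ereal ((1 - a) * r + a * s)"
    using mF[of z] by (meson monoD order_trans)
qed

section \<open>Progress of one full step\<close>

text \<open>
  The two sides of the Taylor bound add up: the regularisation coefficient \<open>p / (p+1)!\<close> dominates the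
  remainder \<open>1 / (p+1)!\<close>, and together they are \<open>(p+1) / (p+1)! = 1 / p!\<close>.
\<close>

lemma full_step_arguments_bounds:
  fixes f :: "'a::euclidean_space \<Rightarrow> real ^ 'm"
  assumes B: "pos_def B" and "open S" "convex S" and "1 \<le> p"
    and g: "\<And>i. times_cont_diff_on p S (\<lambda>z. f z $ i)"
    and lip: "\<And>i. lipschitz_Dp B p S (\<lambda>z. f z $ i) (L $ i)"
    and x: "x \<in> S" and y: "y \<in> S"
  defines "r \<equiv> norm_B B (y - x) ^ (p + 1)"
  shows "f y \<le> taylor p f x y + r *\<^sub>R ((real p / fact (p + 1)) *\<^sub>R L)"
    and "taylor p f x y + r *\<^sub>R ((real p / fact (p + 1)) *\<^sub>R L) \<le> f y + (r / fact p) *\<^sub>R L"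
proof -
  have *: "f y $ i \<le> taylor p f x y $ i + r * (real p / fact (p + 1) * L $ i)"
    "taylor p f x y $ i + r * (real p / fact (p + 1) * L $ i) \<le> f y $ i + r / fact p * L $ i" for i
  proof -
    define q where "q = L $ i * r / fact (p + 1)"
    have "\<bar>f y $ i - taylor p f x y $ i\<bar> \<le> q"
      using taylor_remainder_bound[OF B g \<open>open S\<close> \<open>convex S\<close> lip \<open>1 \<le> p\<close> x y, of i]
      by (simp add: taylor_component q_def r_def)
    moreover have "0 \<le> q"
      using lipschitz_Dp_constant_nonneg[OF B g \<open>open S\<close> lip \<open>1 \<le> p\<close> x, of i] norm_B_nonneg[OF B]
      by (simp add: q_def r_def)
    then have "q \<le> real p * q"
      using \<open>1 \<le> p\<close> mult_right_mono[of 1 "real p" q] by simp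
    moreover have "r * (real p / fact (p + 1) * L $ i) = real p * q"
      by (simp add: q_def)
    moreover have "r / fact p * L $ i = real p * q + q"
      by (simp add: q_def divide_simps) (simp add: algebra_simps)
    ultimately show "f y $ i \<le> taylor p f x y $ i + r * (real p / fact (p + 1) * L $ i)"
      "taylor p f x y $ i + r * (real p / fact (p + 1) * L $ i) \<le> f y $ i + r / fact p * L $ i"
      by linarith+
  qed
  show "f y \<le> taylor p f x y + r *\<^sub>R ((real p / fact (p + 1)) *\<^sub>R L)"
    "taylor p f x y + r *\<^sub>R ((real p / fact (p + 1)) *\<^sub>R L) \<le> f y + (r / fact p) *\<^sub>R L"
    by (simp_all only: less_eq_vec_def vector_add_component vector_scaleR_component real_scaleR_def)
      (intro allI *)+
qed

text \<open>
  One step of the method is at least as good as any competitor \<open>y\<close>, up to the price of the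
  regularisation, which subhomogeneity extracts as a multiple of \<open>F(y, L)\<close>.
\<close>

lemma full_step_progress:
  fixes F :: "'a::euclidean_space \<Rightarrow> real ^ 'm \<Rightarrow> ereal"
  assumes B: "pos_def B" and mF: "\<And>z. mono (F z)" and "open S" "convex S" and "1 \<le> p"
    and g: "\<And>i. times_cont_diff_on p S (\<lambda>z. f z $ i)"
    and lip: "\<And>i. lipschitz_Dp B p S (\<lambda>z. f z $ i) (L $ i)"
    and sub: "subhomogeneous_on (dom_phi F S f) F"
    and "x \<in> S" and y: "y \<in> dom_phi F S f"
    and min: "is_arg_min (full_step_model B p F f L x) (\<lambda>y. y \<in> dom_phi F S f) x'"
  shows "F x' (f x') \<le> F y (f y) + ereal (norm_B B (y - x) ^ (p + 1) / fact p) * F y L"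
proof -
  have x': "x' \<in> dom_phi F S f" and "\<not> full_step_model B p F f L x y < full_step_model B p F f L x x'"
    using min y by (auto simp: is_arg_min_def)
  note bounds = full_step_arguments_bounds[OF B \<open>open S\<close> \<open>convex S\<close> \<open>1 \<le> p\<close> g lip \<open>x \<in> S\<close>]
  have "F x' (f x') \<le> full_step_model B p F f L x x'"
    unfolding full_step_model_def
    by (rule monoD[OF mF bounds(1)]) (use x' in \<open>simp add: dom_phi_def\<close>)
  also have "\<dots> \<le> full_step_model B p F f L x y"
    using \<open>\<not> full_step_model B p F f L x y < _\<close> by simp
  also have "\<dots> \<le> F y (f y + (norm_B B (y - x) ^ (p + 1) / fact p) *\<^sub>R L)"
    unfolding full_step_model_def
    by (rule monoD[OF mF bounds(2)]) (use y in \<open>simp add: dom_phi_def\<close>)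
  also have "\<dots> \<le> F y (f y) + ereal (norm_B B (y - x) ^ (p + 1) / fact p) * F y L"
  proof -
    have "0 \<le> norm_B B (y - x) ^ (p + 1) / fact p"
      using norm_B_nonneg[OF B] by simp
    then show ?thesis
      using sub y unfolding subhomogeneous_on_def by blast
  qed
  finally show ?thesis .
qed

section \<open>The rate of the recurrence\<close>

text \<open>
  Weighting by \<open>A\<^sub>k = k(k+1)\<cdots>(k+p)\<close> makes the recurrence telescope for \<open>\<alpha> = (p+1)/(k+p+1)\<close>,
  because \<open>A\<^sub>k = (1 - \<alpha>) A\<^sub>k\<^sub>+\<^sub>1\<close>. Each step then adds at most
  \<open>C (p+1)\<^sup>p\<^sup>+\<^sup>1 A\<^sub>k\<^sub>+\<^sub>1 / (k+p+1)\<^sup>p\<^sup>+\<^sup>1 \<le> C (p+1)\<^sup>p\<^sup>+\<^sup>1\<close>, so that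
  \<open>A\<^sub>k d\<^sub>k \<le> k C (p+1)\<^sup>p\<^sup>+\<^sup>1\<close>, and \<open>A\<^sub>k \<ge> k\<^sup>p\<^sup>+\<^sup>1\<close>.
\<close>

lemma recurrence_rate:
  fixes d :: "nat \<Rightarrow> real"
  assumes "C \<ge> 0"
    and rec: "\<And>k a. 0 \<le> a \<Longrightarrow> a \<le> 1 \<Longrightarrow> d (Suc k) \<le> (1 - a) * d k + C * a ^ (p + 1)"
    and "\<And>k. d k \<ge> 0" and "k \<ge> 1"
  shows "d k \<le> C * real (p + 1) ^ (p + 1) / real k ^ p"
proof -
  define A where "A k = (\<Prod>i\<le>p. real (k + i))" for k
  define c where "c = C * real (p + 1) ^ (p + 1)"
  have A_shift: "A k * real (k + p + 1) = real k * A (Suc k)" for k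
  proof -
    have "A k * real (k + p + 1) = (\<Prod>i\<le>Suc p. real (k + i))"
      by (simp add: A_def)
    also have "\<dots> = real k * A (Suc k)"
      by (subst prod.atMost_Suc_shift) (simp add: A_def)
    finally show ?thesis .
  qed
  have A_le: "A (Suc k) \<le> real (k + p + 1) ^ (p + 1)" for k
  proof -
    have "A (Suc k) \<le> (\<Prod>i\<le>p. real (k + p + 1))"
      unfolding A_def by (intro prod_mono) auto
    then show ?thesis by simp
  qed
  have A_nonneg: "A k \<ge> 0" for k
    unfolding A_def by (intro prod_nonneg) auto
  have "A k * d k \<le> real k * c" for k
  proof (induction k)
    case 0
    then show ?case by (simp add: A_def prod.atMost_shift)
  next
    case (Suc k)
    define N where "N = real (k + p + 1)"
    define a where "a = real (p + 1) / N"
    have N: "N > 0" by (simp add: N_def)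
    have a: "0 \<le> a" "a \<le> 1" by (simp_all add: a_def N_def)
    have one_minus_a: "1 - a = real k / N"
      by (simp add: a_def N_def field_simps)
    have "A (Suc k) * d (Suc k) \<le> A (Suc k) * ((1 - a) * d k + C * a ^ (p + 1))"
      by (intro mult_left_mono rec a A_nonneg)
    also have "\<dots> = (real k * A (Suc k) / N) * d k + A (Suc k) * (C * a ^ (p + 1))"
      by (simp add: one_minus_a algebra_simps)
    also have "real k * A (Suc k) / N = A k"
      using A_shift[of k] N by (simp add: N_def field_simps)
    also have "A (Suc k) * (C * a ^ (p + 1)) \<le> N ^ (p + 1) * (C * a ^ (p + 1))"
      using A_le[of k] \<open>C \<ge> 0\<close> a unfolding N_def by (intro mult_right_mono) auto
    also have "\<dots> = c"
      using N by (simp add: a_def c_def power_divide)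
    finally show ?case
      using Suc.IH by (simp add: algebra_simps)
  qed
  moreover have "real k * real k ^ p \<le> A k"
  proof -
    have "(\<Prod>i\<le>p. real k) \<le> A k"
      unfolding A_def by (intro prod_mono) auto
    then show ?thesis by simp
  qed
  then have "real k * real k ^ p * d k \<le> A k * d k"
    using assms(3) by (intro mult_right_mono) auto
  ultimately have "real k * (real k ^ p * d k) \<le> real k * c"
    by (smt (verit) mult.assoc)
  then have "real k ^ p * d k \<le> c"
    using \<open>k \<ge> 1\<close> by simp
  then show ?thesis
    using \<open>k \<ge> 1\<close> by (simp add: c_def field_simps)
qed


section \<open>Convergence of the full-step method\<close>

theorem theorem5:
  fixes B :: "'a::euclidean_space \<Rightarrow> 'a \<Rightarrow>\<^sub>L real"
    and F :: "'a \<Rightarrow> real ^ 'm \<Rightarrow> ereal"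
    and S :: "'a set"
    and f :: "'a \<Rightarrow> real ^ 'm"
    and L :: "real ^ 'm"
    and p :: nat
    and xs :: 'a
    and phis :: ereal
    and x :: "nat \<Rightarrow> 'a"
  assumes "pos_def B"
    and "\<And>z u. F z u \<noteq> - \<infinity>"
    and "closed_convex_ext (\<lambda>(z, u). F z u)"
    and "\<And>z. mono (F z)"
    and "open S" and "convex S"
    and "\<And>i. convex_on S (\<lambda>z. f z $ i)"
    and "\<And>i. closed (epigraph S (\<lambda>z. f z $ i))"
    and "subhomogeneous_on (dom_phi F S f) F"
    and "1 \<le> p"
    and "\<And>i. times_cont_diff_on p S (\<lambda>z. f z $ i)"
    and "\<And>i. lipschitz_Dp B p S (\<lambda>z. f z $ i) (L $ i)"
    and "outer_sup F S f L < \<infinity>"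
    and "phis = (INF z \<in> dom_phi F S f. phi F S f z)"
    and "xs \<in> dom_phi F S f" and "phi F S f xs = phis"
    and "x 0 \<in> dom_phi F S f"
    and "level_radius B (phi F S f) xs (x 0) < \<infinity>"
    and "\<And>k. is_arg_min (full_step_model B p F f L (x k)) (\<lambda>y. y \<in> dom_phi F S f) (x (Suc k))"
  shows "\<forall>k\<ge>1. phi F S f (x k) - phis \<le>
     ereal (real (p + 1) ^ (p + 1)) * outer_sup F S f L * level_radius B (phi F S f) xs (x 0) ^ (p + 1)
       / ereal (fact p) * ereal (real k powi (- int p))"
proof -
  note B = assms(1) and not_MInf = assms(2) and mF = assms(4)
  note sub = assms(9) and g = assms(11) and lip = assms(12) and xs = assms(15) and min = assms(19)
  let ?dom = "dom_phi F S f" and ?\<phi> = "phi F S f"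
  define val where "val z = real_of_ereal (F z (f z))" for z
  define Q where "Q = real_of_ereal (outer_sup F S f L)"
  define D where "D = real_of_ereal (level_radius B ?\<phi> xs (x 0))"
  define d where "d k = val (x k) - val xs" for k

  have val: "F z (f z) = ereal (val z)" if "z \<in> ?dom" for z
    using that not_MInf[of z "f z"] unfolding val_def dom_phi_def by (cases "F z (f z)") auto
  have phi: "?\<phi> z = ereal (val z)" if "z \<in> ?dom" for z
    using val[OF that] that by (simp add: phi_def dom_phi_def)
  have in_dom: "x k \<in> ?dom" for k
    using assms(17) min[of "k - 1"] by (cases k) (auto simp: is_arg_min_def)
  then have in_S: "x k \<in> S" for k
    by (simp add: dom_phi_def)
  have "L \<ge> 0"
    using lipschitz_Dp_constant_nonneg[OF B g assms(5) lip assms(10) in_S]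
    by (simp add: less_eq_vec_def)

  have FL_le: "F z L \<le> outer_sup F S f L" if "z \<in> ?dom" for z
    using that by (auto simp: outer_sup_def intro: SUP_upper)
  have FL_nonneg: "0 \<le> F z L" if "z \<in> ?dom" for z
    by (rule subhomogeneous_nonneg[OF sub mF that \<open>L \<ge> 0\<close>])
  have sup_nonneg: "0 \<le> outer_sup F S f L"
    using FL_nonneg[OF xs] FL_le[OF xs] by (rule order_trans)
  then have Q: "outer_sup F S f L = ereal Q" "Q \<ge> 0"
    using assms(13) by (cases "outer_sup F S f L"; simp add: Q_def)+

  have progress: "val (x (Suc k)) \<le> val y + norm_B B (y - x k) ^ (p + 1) / fact p * Q"
    if y: "y \<in> ?dom" for k y
  proof -
    have c: "0 \<le> norm_B B (y - x k) ^ (p + 1) / fact p"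
      using norm_B_nonneg[OF B] by simp
    have "ereal (val (x (Suc k))) \<le> ereal (val y) + ereal (norm_B B (y - x k) ^ (p + 1) / fact p) * F y L"
      using full_step_progress[OF B mF assms(5,6,10) g lip sub in_S y min] val in_dom y by simp
    also have "\<dots> \<le> ereal (val y) + ereal (norm_B B (y - x k) ^ (p + 1) / fact p) * ereal Q"
      using FL_le[OF y] c unfolding Q(1) by (intro add_left_mono ereal_mult_left_mono) auto
    finally show ?thesis by simp
  qed

  \<comment> \<open>The current iterate is itself a competitor, so the values decrease and the level set is kept.\<close>
  have "norm_B B (0 :: 'a) = 0"
    using norm_B_scaleR[OF B, of 0 0] by simp
  then have "val (x (Suc k)) \<le> val (x k)" for k
    using progress[OF in_dom, of k k] by simp
  then have "val (x k) \<le> val (x 0)" for k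
    using lift_Suc_antimono_le[of "\<lambda>k. val (x k)" 0 k] by simp
  then have "x k \<in> {z. ?\<phi> z \<le> ?\<phi> (x 0)}" for k
    by (simp add: phi in_dom)
  then have radius: "ereal (norm_B B (x k - xs)) \<le> level_radius B ?\<phi> xs (x 0)" for k
    unfolding level_radius_def by (rule SUP_upper)
  moreover have "0 \<le> norm_B B (x 0 - xs)"
    by (rule norm_B_nonneg[OF B])
  ultimately have "0 \<le> level_radius B ?\<phi> xs (x 0)"
    by (meson ereal_less_eq(5) order_trans)
  then have D: "level_radius B ?\<phi> xs (x 0) = ereal D" "D \<ge> 0"
    using assms(18) by (cases "level_radius B ?\<phi> xs (x 0)"; simp add: D_def)+

  define C where "C = Q * D ^ (p + 1) / fact p"
  have "C \<ge> 0"
    using Q D by (simp add: C_def)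
  have d_nonneg: "d k \<ge> 0" for k
  proof -
    have "?\<phi> xs \<le> ?\<phi> (x k)"
      using assms(14,16) in_dom by (auto intro: INF_lower)
    then show ?thesis
      by (simp add: d_def phi in_dom xs)
  qed
  have d_step: "d (Suc k) \<le> (1 - a) * d k + C * a ^ (p + 1)" if a: "0 \<le> a" "a \<le> 1" for k a
  proof -
    define y where "y = (1 - a) *\<^sub>R x k + a *\<^sub>R xs"
    have conv: "y \<in> S \<and> F y (f y) \<le> ereal ((1 - a) * val (x k) + a * val xs)"
      using xs by (intro composite_convex[OF assms(3) mF assms(6,7) in_S val[OF in_dom] _ val[OF xs] a y_def])
        (simp add: dom_phi_def)
    then have y: "y \<in> ?dom"
      using le_less_trans[OF conjunct2[OF conv] ereal_less_PInfty] by (simp add: dom_phi_def)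
    have "val y \<le> (1 - a) * val (x k) + a * val xs"
      using conv val[OF y] by simp
    moreover have "norm_B B (y - x k) ^ (p + 1) / fact p * Q \<le> C * a ^ (p + 1)"
    proof -
      have "y - x k = (- a) *\<^sub>R (x k - xs)"
        by (simp add: y_def algebra_simps)
      then have "norm_B B (y - x k) = a * norm_B B (x k - xs)"
        using norm_B_scaleR[OF B, of "- a" "x k - xs"] a by simp
      also have "\<dots> \<le> a * D"
        using radius[of k] D a by (intro mult_left_mono) auto
      finally have "norm_B B (y - x k) ^ (p + 1) \<le> (a * D) ^ (p + 1)"
        using norm_B_nonneg[OF B] by (intro power_mono)
      then have "norm_B B (y - x k) ^ (p + 1) / fact p * Q \<le> (a * D) ^ (p + 1) / fact p * Q"
        using Q(2) by (intro mult_right_mono divide_right_mono) auto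
      then show ?thesis
        by (simp add: C_def power_mult_distrib mult_ac)
    qed
    ultimately show ?thesis
      using progress[OF y, of k] by (simp add: d_def algebra_simps)
  qed

  show ?thesis
  proof (intro allI impI)
    fix k :: nat
    assume "1 \<le> k"
    have "d k \<le> C * real (p + 1) ^ (p + 1) / real k ^ p"
      by (rule recurrence_rate[where d = d and p = p, OF \<open>C \<ge> 0\<close> d_step d_nonneg \<open>1 \<le> k\<close>])
    then have "d k \<le> real (p + 1) ^ (p + 1) * Q * D ^ (p + 1) / fact p * (real k powi (- int p))"
      by (simp add: C_def power_int_minus divide_simps mult_ac)
    moreover have "?\<phi> (x k) - phis = ereal (d k)"
      using assms(16) phi[OF in_dom, of k] phi[OF xs] by (simp add: d_def flip: assms(16))
    ultimately show "?\<phi> (x k) - phis \<le>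
        ereal (real (p + 1) ^ (p + 1)) * outer_sup F S f L * level_radius B ?\<phi> xs (x 0) ^ (p + 1)
          / ereal (fact p) * ereal (real k powi (- int p))"
      unfolding Q(1) D(1) by simp
  qed
qed

end
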